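(* Let $F$ be a field of characteristic zero, let $n\ge 1$ be an integer, and let $\varphi(x)=(\varphi_1(x),\dots,\varphi_n(x))\in F[[x_1,\dots,x_n]]^n$ be an $n$-tuple of formal power series of the form $\varphi(x)=x+(\text{terms of total degree}\ge 2)$, where $x=(x_1,\dots,x_n)$. Let $\varphi^{-1}$ denote the inverse of $\varphi$ with respect to composition of such tuples of formal power series. Then $$\varphi^{-1}(x)=\sum_{m=0}^{\infty}\left(\sum_{k=0}^{m}(-1)^k\binom{m}{k}\varphi^{\circ k}(x)\right)=x+\sum_{m=1}^{\infty}\left(\sum_{k=0}^{m}(-1)^k\binom{m}{k}\varphi^{\circ k}(x)\right),$$ where the infinite sum over $m$ is a sum of formal power series.
   Context: $\varphi^{\circ k}$ denotes the $k$-fold composition of $\varphi$ with itself, and $\varphi^{\circ 0}=\mathrm{id}$, $\mathrm{id}(x)=x$. Infinite sums of formal power series (over $m$) are understood in the formal sense: each coefficient of a monomial receives only finitely many nonzero contributions (equivalently, convergence in the $(x_1,\dots,x_n)$-adic topology, componentwise). *)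

theory Defs
  imports "HOL-Analysis.Finite_Cartesian_Product"
begin

section \<open>Formal power series in finitely many variables\<close>

text \<open>The variables are indexed by a finite type \<open>'n\<close>, so there are \<open>CARD('n) \<ge> 1\<close> of them.
  A monomial is given by its exponent vector of type \<open>nat ^ 'n\<close>.\<close>

typedef ('a, 'n::finite) mfps = "UNIV :: (nat ^ 'n \<Rightarrow> 'a) set"
  morphisms mfps_coeff Abs_mfps
  by simp

lemma mfps_coeff_Abs [simp]: "mfps_coeff (Abs_mfps f) = f"
  by (simp add: Abs_mfps_inverse)

lemma mfps_eqI: "(\<And>e. mfps_coeff f e = mfps_coeff g e) \<Longrightarrow> f = g"
  by (metis ext mfps_coeff_inject)

definition monom_decomps :: "nat ^ 'n::finite \<Rightarrow> ((nat ^ 'n) \<times> (nat ^ 'n)) set" where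
  "monom_decomps e = {(a, b). a + b = e}"

lemma finite_monom_decomps [simp]: "finite (monom_decomps (e :: nat ^ 'n::finite))"
proof -
  let ?B = "vec_lambda ` (PiE UNIV (\<lambda>i. {..e $ i}))"
  have fin: "finite ?B"
    by (intro finite_imageI finite_PiE) auto
  have "a \<in> ?B" if "\<And>i. a $ i \<le> e $ i" for a
    using that by (intro image_eqI[of _ _ "vec_nth a"]) (auto simp: PiE_def extensional_def)
  then have "monom_decomps e \<subseteq> ?B \<times> ?B"
    by (auto simp: monom_decomps_def)
  then show ?thesis
    using fin by (meson finite_SigmaI finite_subset)
qed

instantiation mfps :: (comm_ring_1, finite) comm_ring_1
begin

definition zero_mfps :: "('a, 'b) mfps" where
  "0 = Abs_mfps (\<lambda>e. 0)"

definition one_mfps :: "('a, 'b) mfps" where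
  "1 = Abs_mfps (\<lambda>e. if e = 0 then 1 else 0)"

definition plus_mfps :: "('a, 'b) mfps \<Rightarrow> ('a, 'b) mfps \<Rightarrow> ('a, 'b) mfps" where
  "f + g = Abs_mfps (\<lambda>e. mfps_coeff f e + mfps_coeff g e)"

definition uminus_mfps :: "('a, 'b) mfps \<Rightarrow> ('a, 'b) mfps" where
  "- f = Abs_mfps (\<lambda>e. - mfps_coeff f e)"

definition minus_mfps :: "('a, 'b) mfps \<Rightarrow> ('a, 'b) mfps \<Rightarrow> ('a, 'b) mfps" where
  "f - g = Abs_mfps (\<lambda>e. mfps_coeff f e - mfps_coeff g e)"

definition times_mfps :: "('a, 'b) mfps \<Rightarrow> ('a, 'b) mfps \<Rightarrow> ('a, 'b) mfps" where
  "f * g = Abs_mfps (\<lambda>e. \<Sum>(a, b)\<in>monom_decomps e. mfps_coeff f a * mfps_coeff g b)"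

instance
proof
  fix f g h :: "('a, 'b) mfps"
  show "f + g + h = f + (g + h)" "f + g = g + f" "f - g = f + - g"
    by (simp_all add: plus_mfps_def uminus_mfps_def minus_mfps_def ac_simps)
  show "0 + f = f" "- f + f = 0"
    by (rule mfps_eqI, simp add: plus_mfps_def zero_mfps_def uminus_mfps_def)+
  have "mfps_coeff (0 :: ('a, 'b) mfps) 0 \<noteq> mfps_coeff 1 0"
    by (simp add: zero_mfps_def one_mfps_def)
  then show "(0 :: ('a, 'b) mfps) \<noteq> 1"
    by auto
  show "(f + g) * h = f * h + g * h"
    by (simp add: plus_mfps_def times_mfps_def case_prod_unfold sum.distrib distrib_right)
  show "f * g = g * f"
  proof (rule mfps_eqI)
    fix e :: "nat ^ 'b"
    have "(\<Sum>p\<in>monom_decomps e. mfps_coeff f (fst p) * mfps_coeff g (snd p)) =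
        (\<Sum>p\<in>monom_decomps e. mfps_coeff g (fst p) * mfps_coeff f (snd p))"
      by (rule sum.reindex_bij_witness[of _ prod.swap prod.swap])
        (auto simp: monom_decomps_def add.commute mult.commute)
    then show "mfps_coeff (f * g) e = mfps_coeff (g * f) e"
      by (simp add: times_mfps_def case_prod_unfold)
  qed
  show "1 * f = f"
  proof (rule mfps_eqI)
    fix e :: "nat ^ 'b"
    have "mfps_coeff (1 * f) e =
        (\<Sum>p\<in>monom_decomps e. (if fst p = 0 then 1 else 0) * mfps_coeff f (snd p))"
      by (simp add: times_mfps_def one_mfps_def case_prod_unfold)
    also have "\<dots> = (\<Sum>p\<in>{(0 :: nat ^ 'b, e)}. (if fst p = 0 then 1 else 0) * mfps_coeff f (snd p))"
      by (rule sum.mono_neutral_right[OF finite_monom_decomps]) (auto simp: monom_decomps_def)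
    finally show "mfps_coeff (1 * f) e = mfps_coeff f e"
      by simp
  qed
  show "f * g * h = f * (g * h)"
  proof (rule mfps_eqI)
    fix e :: "nat ^ 'b"
    have "mfps_coeff (f * g * h) e =
        (\<Sum>p\<in>monom_decomps e. \<Sum>q\<in>monom_decomps (fst p).
           mfps_coeff f (fst q) * mfps_coeff g (snd q) * mfps_coeff h (snd p))"
      by (simp add: times_mfps_def case_prod_unfold sum_distrib_right)
    also have "\<dots> = (\<Sum>x\<in>Sigma (monom_decomps e) (\<lambda>p. monom_decomps (fst p)).
           mfps_coeff f (fst (snd x)) * mfps_coeff g (snd (snd x)) * mfps_coeff h (snd (fst x)))"
      by (subst sum.Sigma) (auto simp: case_prod_unfold)
    also have "\<dots> = (\<Sum>x\<in>Sigma (monom_decomps e) (\<lambda>p. monom_decomps (snd p)).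
           mfps_coeff f (fst (fst x)) * (mfps_coeff g (fst (snd x)) * mfps_coeff h (snd (snd x))))"
      by (rule sum.reindex_bij_witness[of _
            "\<lambda>((a, bc), (b, c)). ((a + b, c), (a, b))" "\<lambda>((ab, c), (a, b)). ((a, b + c), (b, c))"])
        (auto simp: monom_decomps_def add.assoc mult.assoc)
    also have "\<dots> = (\<Sum>p\<in>monom_decomps e. \<Sum>q\<in>monom_decomps (snd p).
           mfps_coeff f (fst p) * (mfps_coeff g (fst q) * mfps_coeff h (snd q)))"
      by (subst sum.Sigma) (auto simp: case_prod_unfold)
    also have "\<dots> = mfps_coeff (f * (g * h)) e"
      by (simp add: times_mfps_def case_prod_unfold sum_distrib_left)
    finally show "mfps_coeff (f * g * h) e = mfps_coeff (f * (g * h)) e" .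
  qed
qed

end

definition mdeg :: "nat ^ 'n::finite \<Rightarrow> nat" where
  "mdeg e = (\<Sum>i\<in>UNIV. e $ i)"

section \<open>Tuples of power series under composition\<close>

definition mfps_vars :: "('a::comm_ring_1, 'n::finite) mfps ^ 'n" where
  "mfps_vars = (\<chi> i. Abs_mfps (\<lambda>e. if e = axis i 1 then 1 else 0))"

definition mfps_no_const :: "('a::comm_ring_1, 'n::finite) mfps ^ 'n \<Rightarrow> bool" where
  "mfps_no_const g \<longleftrightarrow> (\<forall>i. mfps_coeff (g $ i) 0 = 0)"

definition mfps_monom_eval :: "nat ^ 'n::finite \<Rightarrow> ('a::comm_ring_1, 'n) mfps ^ 'n \<Rightarrow> ('a, 'n) mfps"
  where "mfps_monom_eval d g = (\<Prod>i\<in>UNIV. (g $ i) ^ (d $ i))"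

text \<open>Substitution of \<open>g\<close> into \<open>f\<close>. As for univariate series, it is meaningful
  only if \<open>g\<close> has no constant term; then the monomials \<open>d\<close> of \<open>f\<close> of degree larger than the
  degree of \<open>e\<close> do not contribute to the coefficient at \<open>e\<close>
  (lemma \<open>mfps_monom_eval_coeff_eq_0\<close> below).\<close>

definition mfps_subst :: "('a::comm_ring_1, 'n::finite) mfps \<Rightarrow> ('a, 'n) mfps ^ 'n \<Rightarrow> ('a, 'n) mfps"
  where "mfps_subst f g =
    Abs_mfps (\<lambda>e. \<Sum>d | mdeg d \<le> mdeg e. mfps_coeff f d * mfps_coeff (mfps_monom_eval d g) e)"

lemma finite_mdeg_le [simp]: "finite {d :: nat ^ 'n::finite. mdeg d \<le> m}"
proof -
  have "{d :: nat ^ 'n. mdeg d \<le> m} \<subseteq> fst ` monom_decomps (\<chi> i. m)"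
  proof
    fix d :: "nat ^ 'n"
    assume "d \<in> {d. mdeg d \<le> m}"
    then have *: "d $ i \<le> m" for i
      using member_le_sum[of i UNIV "\<lambda>i. d $ i"] by (force simp: mdeg_def)
    then have "(d, \<chi> i. m - d $ i) \<in> monom_decomps (\<chi> i. m)"
      by (auto simp: monom_decomps_def vec_eq_iff)
    then show "d \<in> fst ` monom_decomps (\<chi> i. m)"
      by force
  qed
  then show ?thesis
    by (meson finite_imageI finite_monom_decomps finite_subset)
qed

lemma mdeg_add: "mdeg (a + b) = mdeg a + mdeg b"
  by (simp add: mdeg_def sum.distrib)

lemma mfps_order_mult:
  fixes f g :: "('a::comm_ring_1, 'n::finite) mfps"
  assumes f: "\<And>e. mdeg e < k \<Longrightarrow> mfps_coeff f e = 0"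
    and g: "\<And>e. mdeg e < l \<Longrightarrow> mfps_coeff g e = 0"
    and e: "mdeg e < k + l"
  shows "mfps_coeff (f * g) e = 0"
proof -
  have "mfps_coeff f a * mfps_coeff g b = 0" if "a + b = e" for a b
  proof (cases "mdeg a < k")
    case False
    then have "mdeg b < l"
      using e that by (auto simp: mdeg_add)
    then show ?thesis
      by (simp add: g)
  qed (simp add: f)
  then show ?thesis
    by (auto simp: times_mfps_def monom_decomps_def intro!: sum.neutral)
qed

lemma mfps_order_power:
  fixes f :: "('a::comm_ring_1, 'n::finite) mfps"
  assumes "mfps_coeff f 0 = 0" "mdeg e < k"
  shows "mfps_coeff (f ^ k) e = 0"
  using assms(2)
proof (induction k arbitrary: e)
  case (Suc k)
  have "e = 0" if "mdeg e < 1" for e :: "nat ^ 'n"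
    using that by (simp add: mdeg_def vec_eq_iff)
  then have "mfps_coeff f e = 0" if "mdeg e < 1" for e
    using that assms(1) by metis
  then have "mfps_coeff (f * f ^ k) e = 0"
    using Suc by (intro mfps_order_mult[of 1 f k]) auto
  then show ?case
    by simp
qed simp

lemma mfps_monom_eval_coeff_eq_0:
  fixes g :: "('a::comm_ring_1, 'n::finite) mfps ^ 'n"
  assumes "mfps_no_const g" "mdeg e < mdeg d"
  shows "mfps_coeff (mfps_monom_eval d g) e = 0"
proof -
  have "mfps_coeff (\<Prod>i\<in>A. (g $ i) ^ (d $ i)) e = 0"
    if "finite A" "mdeg e < (\<Sum>i\<in>A. d $ i)" for A e
    using that
  proof (induction A arbitrary: e rule: finite_induct)
    case (insert i A)
    have "mfps_coeff ((g $ i) ^ (d $ i)) e = 0" if "mdeg e < d $ i" for e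
      using that assms(1) by (intro mfps_order_power) (auto simp: mfps_no_const_def)
    then have "mfps_coeff ((g $ i) ^ (d $ i) * (\<Prod>i\<in>A. (g $ i) ^ (d $ i))) e = 0"
      using insert by (intro mfps_order_mult[of "d $ i" _ "\<Sum>i\<in>A. d $ i"]) auto
    then show ?case
      using insert.hyps by simp
  qed simp
  then show ?thesis
    using assms(2) by (simp add: mfps_monom_eval_def mdeg_def)
qed

definition mfps_compose ::
    "('a::comm_ring_1, 'n::finite) mfps ^ 'n \<Rightarrow> ('a, 'n) mfps ^ 'n \<Rightarrow> ('a, 'n) mfps ^ 'n"
  where "mfps_compose f g = (\<chi> i. mfps_subst (f $ i) g)"

definition mfps_iter :: "nat \<Rightarrow> ('a::comm_ring_1, 'n::finite) mfps ^ 'n \<Rightarrow> ('a, 'n) mfps ^ 'n" where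
  "mfps_iter k f = (mfps_compose f ^^ k) mfps_vars"

definition mfps_comp_inverse ::
    "('a::comm_ring_1, 'n::finite) mfps ^ 'n \<Rightarrow> ('a, 'n) mfps ^ 'n \<Rightarrow> bool"
  where "mfps_comp_inverse f g \<longleftrightarrow> mfps_no_const g \<and>
    mfps_compose f g = mfps_vars \<and> mfps_compose g f = mfps_vars"

definition mfps_inv :: "('a::comm_ring_1, 'n::finite) mfps ^ 'n \<Rightarrow> ('a, 'n) mfps ^ 'n" where
  "mfps_inv f = (THE g. mfps_comp_inverse f g)"

section \<open>Formal infinite sums of tuples\<close>

text \<open>Sums are taken coefficientwise; \<open>mfps_infsum\<close> is meaningful for summable families only.\<close>

definition mfps_summable ::
    "('m \<Rightarrow> ('a::comm_ring_1, 'n::finite) mfps ^ 'n) \<Rightarrow> 'm set \<Rightarrow> bool"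
  where "mfps_summable s M \<longleftrightarrow> (\<forall>i e. finite {m \<in> M. mfps_coeff (s m $ i) e \<noteq> 0})"

definition mfps_infsum ::
    "('m \<Rightarrow> ('a::comm_ring_1, 'n::finite) mfps ^ 'n) \<Rightarrow> 'm set \<Rightarrow> ('a, 'n) mfps ^ 'n"
  where "mfps_infsum s M =
    (\<chi> i. Abs_mfps (\<lambda>e. \<Sum>m | m \<in> M \<and> mfps_coeff (s m $ i) e \<noteq> 0. mfps_coeff (s m $ i) e))"

end

theory Submission
  imports Defs
begin

text \<open>
  Right composition with \<open>\<phi>\<close>, the operator \<open>C f = f \<circ> \<phi>\<close>, is linear in \<open>f\<close>, although composition is
  not linear in \<open>\<phi>\<close>. Since iterates of \<open>\<phi>\<close> commute with \<open>\<phi>\<close>, one has \<open>\<phi>\<^sup>k = C\<^sup>k x\<close>, and by the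
  binomial theorem the \<open>m\<close>-th term of the series is \<open>s\<^sub>m = (1 - C)\<^sup>m x\<close>. So the claim is the Neumann
  series \<open>C\<inverse> = (1 - (1 - C))\<inverse> = \<Sum> (1 - C)\<^sup>m\<close> applied to \<open>x\<close>.

  It converges because \<open>\<phi>\<close> agrees with the identity up to degree one: the monomial \<open>x\<^sup>d\<close> and its
  image \<open>\<phi>\<^sup>d\<close> then have the same part of degree \<open>|d|\<close>, so \<open>1 - C\<close> raises the order by at least one
  (\<open>order_ge_minus_subst\<close>), and \<open>s\<^sub>m\<close> has order at least \<open>m + 1\<close>. The partial sums telescope under
  \<open>C\<close>, to \<open>s\<^sub>0 - s\<^sub>N\<close> for the first \<open>N\<close> terms, so the sum \<open>\<psi>\<close> satisfies \<open>\<psi> \<circ> \<phi> = x\<close>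
  (\<open>neumann_series_left_inverse\<close>).

  This makes \<open>\<psi>\<close> a left inverse. As \<open>\<psi>\<close> also agrees with the identity up to degree one, it has a left
  inverse of its own, which associativity identifies with \<open>\<phi>\<close>; hence \<open>\<phi> \<circ> \<psi> = x\<close>, and the
  two-sided inverse is unique. Besides this, the proof needs that substitution is a ring
  homomorphism and that composition is associative (\<open>subst_mult\<close>, \<open>subst_subst\<close>).
\<close>

section \<open>Coefficients and order\<close>

lemma coeff_0 [simp]: "mfps_coeff 0 e = 0"
  by (simp add: zero_mfps_def)

lemma coeff_add [simp]: "mfps_coeff (f + g) e = mfps_coeff f e + mfps_coeff g e"
  by (simp add: plus_mfps_def)

lemma coeff_minus [simp]: "mfps_coeff (- f) e = - mfps_coeff f e"
  by (simp add: uminus_mfps_def)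

lemma coeff_diff [simp]: "mfps_coeff (f - g) e = mfps_coeff f e - mfps_coeff g e"
  by (simp add: minus_mfps_def)

lemma coeff_sum: "mfps_coeff (\<Sum>x\<in>A. f x) e = (\<Sum>x\<in>A. mfps_coeff (f x) e)"
  by (induction A rule: infinite_finite_induct) auto

lemma coeff_mult:
  "mfps_coeff (f * g) e = (\<Sum>p\<in>monom_decomps e. mfps_coeff f (fst p) * mfps_coeff g (snd p))"
  by (simp add: times_mfps_def case_prod_unfold)

lemma mdeg_0 [simp]: "mdeg 0 = 0"
  by (simp add: mdeg_def)

lemma mdeg_eq_0_iff [simp]: "mdeg e = 0 \<longleftrightarrow> e = 0"
  by (simp add: mdeg_def vec_eq_iff)

lemma mdeg_axis [simp]: "mdeg (axis i 1) = 1"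
  by (simp add: mdeg_def axis_def)

definition order_ge :: "nat \<Rightarrow> ('a::comm_ring_1, 'n::finite) mfps \<Rightarrow> bool" where
  "order_ge k f \<longleftrightarrow> (\<forall>e. mdeg e < k \<longrightarrow> mfps_coeff f e = 0)"

lemma order_ge_mult: "order_ge k f \<Longrightarrow> order_ge l g \<Longrightarrow> order_ge (k + l) (f * g)"
  unfolding order_ge_def using mfps_order_mult by blast

lemma order_ge_add: "order_ge k f \<Longrightarrow> order_ge k g \<Longrightarrow> order_ge k (f + g)"
  by (simp add: order_ge_def)

text \<open>The product rule for leading parts: agreement of \<open>f, f'\<close> in degree \<open>k\<close> and of \<open>g, g'\<close> in
  degree \<open>l\<close>, all lower parts being zero, gives agreement of the products in degree \<open>k + l\<close>.\<close>

lemma order_ge_mult_diff: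
  assumes "order_ge k f'" "order_ge l g"
    and "order_ge (Suc k) (f - f')" "order_ge (Suc l) (g - g')"
  shows "order_ge (Suc (k + l)) (f * g - f' * g')"
proof -
  have "order_ge (Suc (k + l)) ((f - f') * g + f' * (g - g'))"
    using order_ge_add order_ge_mult[OF assms(3,2)] order_ge_mult[OF assms(1,4)] by simp
  also have "(f - f') * g + f' * (g - g') = f * g - f' * g'"
    by (simp add: algebra_simps)
  finally show ?thesis .
qed

lemma order_ge_power:
  assumes "order_ge 1 f"
  shows "order_ge k (f ^ k)"
proof (induction k)
  case 0
  show ?case by (simp add: order_ge_def)
next
  case (Suc k)
  then show ?case
    using order_ge_mult[OF assms, of k "f ^ k"] by simp
qed

lemma order_ge_power_diff:
  assumes "order_ge 1 f" "order_ge 1 g" "order_ge 2 (f - g)"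
  shows "order_ge (Suc k) (f ^ k - g ^ k)"
proof (induction k)
  case 0
  show ?case by (simp add: order_ge_def)
next
  case (Suc k)
  then show ?case
    using order_ge_mult_diff[of 1 g k "f ^ k" f "g ^ k"] assms(3) order_ge_power[OF assms(1)]
      assms(2) by (simp add: numeral_2_eq_2)
qed

lemma no_const_order_ge: "mfps_no_const g \<Longrightarrow> order_ge 1 (g $ i)"
  by (simp add: mfps_no_const_def order_ge_def)

text \<open>The part of degree \<open>|d|\<close> of \<open>g\<^sup>d\<close> is the lowest one that can be nonzero, and it is the monomial
  \<open>d\<close> evaluated at the linear part of \<open>g\<close>; so tuples with the same linear part share it.\<close>

lemma monom_eval_diff_order:
  fixes g h :: "('a::comm_ring_1, 'n::finite) mfps ^ 'n"
  assumes g: "mfps_no_const g" and h: "mfps_no_const h"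
    and gh: "\<And>i. order_ge 2 (g $ i - h $ i)"
  shows "order_ge (Suc (mdeg d)) (mfps_monom_eval d g - mfps_monom_eval d h)"
proof -
  have "order_ge (\<Sum>i\<in>A. d $ i) (\<Prod>i\<in>A. (g $ i) ^ (d $ i)) \<and>
        order_ge (Suc (\<Sum>i\<in>A. d $ i)) ((\<Prod>i\<in>A. (g $ i) ^ (d $ i)) - (\<Prod>i\<in>A. (h $ i) ^ (d $ i)))"
    if "finite A" for A
    using that
  proof (induction A rule: finite_induct)
    case empty
    show ?case by (simp add: order_ge_def)
  next
    case (insert i A)
    have pow: "order_ge (d $ i) ((g $ i) ^ (d $ i))" "order_ge (d $ i) ((h $ i) ^ (d $ i))"
      "order_ge (Suc (d $ i)) ((g $ i) ^ (d $ i) - (h $ i) ^ (d $ i))"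
      by (intro order_ge_power order_ge_power_diff no_const_order_ge g h gh)+
    have "order_ge (d $ i + (\<Sum>i\<in>A. d $ i)) ((g $ i) ^ (d $ i) * (\<Prod>i\<in>A. (g $ i) ^ (d $ i)))"
      using insert.IH by (intro order_ge_mult pow) simp
    moreover have "order_ge (Suc (d $ i + (\<Sum>i\<in>A. d $ i)))
        ((g $ i) ^ (d $ i) * (\<Prod>i\<in>A. (g $ i) ^ (d $ i)) -
         (h $ i) ^ (d $ i) * (\<Prod>i\<in>A. (h $ i) ^ (d $ i)))"
      using insert.IH by (intro order_ge_mult_diff pow) simp_all
    ultimately show ?case
      using insert.hyps by simp
  qed
  then show ?thesis
    by (simp add: mfps_monom_eval_def mdeg_def)
qed

section \<open>Monomials\<close>

definition monomial :: "nat ^ 'n \<Rightarrow> ('a::comm_ring_1, 'n::finite) mfps" where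
  "monomial d = Abs_mfps (\<lambda>e. if e = d then 1 else 0)"

lemma coeff_monomial: "mfps_coeff (monomial d) e = (if e = d then 1 else 0)"
  by (simp add: monomial_def)

lemma vars_nth: "mfps_vars $ i = monomial (axis i 1)"
  by (simp add: mfps_vars_def monomial_def)

lemma monomial_0: "monomial 0 = 1"
  by (simp add: monomial_def one_mfps_def)

lemma monomial_mult: "monomial a * monomial b = (monomial (a + b) :: ('a::comm_ring_1, 'n::finite) mfps)"
proof (rule mfps_eqI)
  fix e :: "nat ^ 'n"
  have "mfps_coeff (monomial a * monomial b :: ('a, 'n) mfps) e =
      (\<Sum>p\<in>monom_decomps e. if p = (a, b) then 1 else 0)"
    unfolding coeff_mult by (intro sum.cong) (auto simp: coeff_monomial prod_eq_iff)
  also have "\<dots> = mfps_coeff (monomial (a + b)) e"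
    by (simp add: coeff_monomial) (auto simp: monom_decomps_def)
  finally show "mfps_coeff (monomial a * monomial b :: ('a, 'n) mfps) e = mfps_coeff (monomial (a + b)) e" .
qed

lemma monomial_axis_power:
  "monomial (axis i 1) ^ k = (monomial (axis i k) :: ('a::comm_ring_1, 'n::finite) mfps)"
proof (induction k)
  case 0
  have "axis i 0 = (0 :: nat ^ 'n)"
    by (simp add: vec_eq_iff axis_def)
  then show ?case by (metis power_0 monomial_0)
next
  case (Suc k)
  have "axis i 1 + axis i k = (axis i (Suc k) :: nat ^ 'n)"
    by (simp add: vec_eq_iff axis_def)
  then show ?case by (simp add: Suc monomial_mult del: One_nat_def)
qed

lemma prod_monomial: "(\<Prod>i\<in>A. monomial (f i)) = monomial (\<Sum>i\<in>A. f i)"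
  by (induction A rule: infinite_finite_induct) (simp_all add: monomial_0 monomial_mult)

lemma monom_eval_vars: "mfps_monom_eval d mfps_vars = monomial d"
proof -
  have "(\<Sum>i\<in>UNIV. axis i (d $ i)) = d"
    by (simp add: vec_eq_iff axis_def)
  then show ?thesis
    by (simp add: mfps_monom_eval_def vars_nth monomial_axis_power prod_monomial del: One_nat_def)
qed

lemma monom_eval_0: "mfps_monom_eval 0 g = 1"
  by (simp add: mfps_monom_eval_def)

lemma monom_eval_add: "mfps_monom_eval (a + b) g = mfps_monom_eval a g * mfps_monom_eval b g"
  by (simp add: mfps_monom_eval_def power_add prod.distrib)

lemma monom_eval_axis: "mfps_monom_eval (axis i 1) g = g $ i"
proof -
  have "mfps_monom_eval (axis i 1) g = (\<Prod>j\<in>UNIV. if j = i then g $ j else 1)"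
    unfolding mfps_monom_eval_def by (intro prod.cong) (auto simp: axis_def)
  then show ?thesis by simp
qed

section \<open>Substitution is a ring homomorphism\<close>

lemma coeff_subst:
  "mfps_coeff (mfps_subst f g) e =
    (\<Sum>d | mdeg d \<le> mdeg e. mfps_coeff f d * mfps_coeff (mfps_monom_eval d g) e)"
  by (simp add: mfps_subst_def)

text \<open>The coefficient at \<open>e\<close> may be computed with any large enough cut-off for the monomials of
  \<open>f\<close>; a common cut-off is what allows sums to be interchanged below.\<close>

lemma coeff_subst_upto:
  assumes "mfps_no_const g" "mdeg e \<le> N"
  shows "mfps_coeff (mfps_subst f g) e =
    (\<Sum>d | mdeg d \<le> N. mfps_coeff f d * mfps_coeff (mfps_monom_eval d g) e)"
  unfolding coeff_subst
  using assms mfps_monom_eval_coeff_eq_0[OF assms(1)]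
  by (intro sum.mono_neutral_left) (auto simp: not_le)

lemma coeff_subst_cong:
  assumes "\<And>d. mdeg d \<le> mdeg e \<Longrightarrow> mfps_coeff f d = mfps_coeff f' d"
  shows "mfps_coeff (mfps_subst f g) e = mfps_coeff (mfps_subst f' g) e"
  unfolding coeff_subst using assms by (intro sum.cong) auto

lemma subst_0: "mfps_subst 0 g = 0"
  by (rule mfps_eqI) (simp add: coeff_subst)

lemma subst_add: "mfps_subst (f + f') g = mfps_subst f g + mfps_subst f' g"
  by (rule mfps_eqI) (simp add: coeff_subst sum.distrib distrib_right)

lemma subst_minus: "mfps_subst (- f) g = - mfps_subst f g"
  by (rule mfps_eqI) (simp add: coeff_subst sum_negf)

lemma subst_sum: "mfps_subst (\<Sum>x\<in>A. f x) g = (\<Sum>x\<in>A. mfps_subst (f x) g)"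
  by (induction A rule: infinite_finite_induct) (simp_all add: subst_0 subst_add)

lemma subst_vars_nth:
  assumes "mfps_no_const g"
  shows "mfps_subst (mfps_vars $ i) g = g $ i"
proof (rule mfps_eqI)
  fix e :: "nat ^ 'b"
  \<comment> \<open>The cut-off must be at least 1 for the monomial \<open>x\<^sub>i\<close> to be counted, even if \<open>e = 0\<close>.\<close>
  have "mfps_coeff (mfps_subst (mfps_vars $ i) g) e =
      (\<Sum>d | mdeg d \<le> Suc (mdeg e). if d = axis i 1 then mfps_coeff (mfps_monom_eval d g) e else 0)"
    by (subst coeff_subst_upto[OF assms le_SucI[OF order_refl]])
      (intro sum.cong, auto simp: vars_nth coeff_monomial)
  then show "mfps_coeff (mfps_subst (mfps_vars $ i) g) e = mfps_coeff (g $ i) e"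
    by (simp add: monom_eval_axis del: One_nat_def)
qed

lemma subst_vars: "mfps_subst f mfps_vars = f"
proof (rule mfps_eqI)
  fix e
  have "mfps_coeff (mfps_subst f mfps_vars) e =
      (\<Sum>d | mdeg d \<le> mdeg e. if d = e then mfps_coeff f d else 0)"
    unfolding coeff_subst by (intro sum.cong) (auto simp: monom_eval_vars coeff_monomial)
  then show "mfps_coeff (mfps_subst f mfps_vars) e = mfps_coeff f e"
    by simp
qed

lemma subst_1: "mfps_subst 1 g = (1 :: ('a::comm_ring_1, 'n::finite) mfps)"
proof (rule mfps_eqI)
  fix e :: "nat ^ 'n"
  have "mfps_coeff (mfps_subst 1 g) e =
      (\<Sum>d\<in>{d :: nat ^ 'n. mdeg d \<le> mdeg e}. if d = 0 then mfps_coeff 1 e else 0)"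
    unfolding coeff_subst
    by (intro sum.cong) (auto simp: monom_eval_0 one_mfps_def)
  then show "mfps_coeff (mfps_subst 1 g) e = mfps_coeff 1 e"
    by simp
qed

text \<open>Both sides have as coefficient at \<open>e\<close> the sum of \<open>f\<^sub>a h\<^sub>b\<close> times the coefficient of
  \<open>g\<^sup>a g\<^sup>b\<close> at \<open>e\<close>, over \<open>a\<close> and \<open>b\<close> up to a common cut-off degree.\<close>

lemma subst_mult:
  fixes f h :: "('a::comm_ring_1, 'n::finite) mfps"
  assumes g: "mfps_no_const g"
  shows "mfps_subst (f * h) g = mfps_subst f g * mfps_subst h g"
proof (rule mfps_eqI)
  fix e :: "nat ^ 'n"
  let ?B = "{d :: nat ^ 'n. mdeg d \<le> mdeg e}"
  let ?t = "\<lambda>a b. mfps_coeff f a * mfps_coeff h b *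
    mfps_coeff (mfps_monom_eval a g * mfps_monom_eval b g) e"
  have "mfps_coeff (mfps_subst (f * h) g) e =
      (\<Sum>d\<in>?B. \<Sum>p\<in>monom_decomps d. ?t (fst p) (snd p))"
    unfolding coeff_subst coeff_mult[of f h] sum_distrib_right
    by (intro sum.cong refl) (auto simp: monom_decomps_def monom_eval_add)
  also have "\<dots> = (\<Sum>x\<in>Sigma ?B monom_decomps. ?t (fst (snd x)) (snd (snd x)))"
    by (subst sum.Sigma) (auto simp: case_prod_unfold)
  also have "\<dots> = (\<Sum>p\<in>{p. mdeg (fst p + snd p) \<le> mdeg e}. ?t (fst p) (snd p))"
    by (rule sum.reindex_bij_witness[of _ "\<lambda>p. (fst p + snd p, p)" snd])
      (auto simp: monom_decomps_def)
  also have "\<dots> = (\<Sum>p\<in>?B \<times> ?B. ?t (fst p) (snd p))"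
  proof (rule sum.mono_neutral_left)
    show "\<forall>p\<in>?B \<times> ?B - {p. mdeg (fst p + snd p) \<le> mdeg e}. ?t (fst p) (snd p) = 0"
      using mfps_monom_eval_coeff_eq_0[OF g]
      by (auto simp flip: monom_eval_add simp: not_le)
  qed (auto simp: mdeg_add)
  also have "\<dots> = (\<Sum>a\<in>?B. \<Sum>b\<in>?B. ?t a b)"
    by (simp add: sum.cartesian_product case_prod_unfold)
  also have "\<dots> = (\<Sum>a\<in>?B. \<Sum>b\<in>?B. \<Sum>p\<in>monom_decomps e.
      (mfps_coeff f a * mfps_coeff (mfps_monom_eval a g) (fst p)) *
      (mfps_coeff h b * mfps_coeff (mfps_monom_eval b g) (snd p)))"
    by (simp add: coeff_mult sum_distrib_left mult_ac)
  also have "\<dots> = (\<Sum>p\<in>monom_decomps e. \<Sum>a\<in>?B. \<Sum>b\<in>?B.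
      (mfps_coeff f a * mfps_coeff (mfps_monom_eval a g) (fst p)) *
      (mfps_coeff h b * mfps_coeff (mfps_monom_eval b g) (snd p)))"
    by (simp only: sum.swap[of _ ?B "monom_decomps e"])
  also have "\<dots> = (\<Sum>p\<in>monom_decomps e.
      mfps_coeff (mfps_subst f g) (fst p) * mfps_coeff (mfps_subst h g) (snd p))"
  proof (rule sum.cong[OF refl])
    fix p :: "(nat ^ 'n) \<times> (nat ^ 'n)"
    assume "p \<in> monom_decomps e"
    then have "mdeg (fst p) \<le> mdeg e" "mdeg (snd p) \<le> mdeg e"
      by (auto simp: monom_decomps_def mdeg_add)
    then show "(\<Sum>a\<in>?B. \<Sum>b\<in>?B. (mfps_coeff f a * mfps_coeff (mfps_monom_eval a g) (fst p)) *
        (mfps_coeff h b * mfps_coeff (mfps_monom_eval b g) (snd p))) =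
        mfps_coeff (mfps_subst f g) (fst p) * mfps_coeff (mfps_subst h g) (snd p)"
      by (simp add: coeff_subst_upto[OF g] sum_product)
  qed
  also have "\<dots> = mfps_coeff (mfps_subst f g * mfps_subst h g) e"
    by (simp add: coeff_mult)
  finally show "mfps_coeff (mfps_subst (f * h) g) e =
      mfps_coeff (mfps_subst f g * mfps_subst h g) e" .
qed

lemma subst_power:
  "mfps_no_const g \<Longrightarrow> mfps_subst (f ^ k) g = mfps_subst f g ^ k"
  by (induction k) (simp_all add: subst_1 subst_mult)

lemma subst_prod:
  "mfps_no_const g \<Longrightarrow> mfps_subst (\<Prod>x\<in>A. f x) g = (\<Prod>x\<in>A. mfps_subst (f x) g)"
  by (induction A rule: infinite_finite_induct) (simp_all add: subst_1 subst_mult)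

lemma subst_of_nat: "mfps_subst (of_nat k) g = of_nat k"
  by (induction k) (simp_all add: subst_0 subst_1 subst_add)

section \<open>Composition is associative\<close>

lemma subst_monom_eval:
  "mfps_no_const h \<Longrightarrow> mfps_subst (mfps_monom_eval d g) h = mfps_monom_eval d (mfps_compose g h)"
  by (simp add: mfps_monom_eval_def subst_prod subst_power mfps_compose_def)

text \<open>Linearity in \<open>f\<close> reduces the claim to monomials, where it is multiplicativity.\<close>

lemma subst_subst:
  fixes f :: "('a::comm_ring_1, 'n::finite) mfps"
  assumes g: "mfps_no_const g" and h: "mfps_no_const h"
  shows "mfps_subst (mfps_subst f g) h = mfps_subst f (mfps_compose g h)"
proof (rule mfps_eqI)
  fix e :: "nat ^ 'n"
  let ?B = "{d :: nat ^ 'n. mdeg d \<le> mdeg e}"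
  have "mfps_coeff (mfps_subst (mfps_subst f g) h) e =
      (\<Sum>d\<in>?B. \<Sum>c\<in>?B. mfps_coeff f c *
        (mfps_coeff (mfps_monom_eval c g) d * mfps_coeff (mfps_monom_eval d h) e))"
    unfolding coeff_subst[of "mfps_subst f g"]
    by (intro sum.cong refl) (simp add: coeff_subst_upto[OF g] sum_distrib_right mult.assoc)
  also have "\<dots> = (\<Sum>c\<in>?B. \<Sum>d\<in>?B. mfps_coeff f c *
        (mfps_coeff (mfps_monom_eval c g) d * mfps_coeff (mfps_monom_eval d h) e))"
    by (rule sum.swap)
  also have "\<dots> = (\<Sum>c\<in>?B. mfps_coeff f c * mfps_coeff (mfps_subst (mfps_monom_eval c g) h) e)"
    by (simp add: coeff_subst sum_distrib_left)
  also have "\<dots> = mfps_coeff (mfps_subst f (mfps_compose g h)) e"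
    by (simp add: subst_monom_eval[OF h] coeff_subst)
  finally show "mfps_coeff (mfps_subst (mfps_subst f g) h) e =
      mfps_coeff (mfps_subst f (mfps_compose g h)) e" .
qed

lemma compose_assoc:
  "mfps_no_const g \<Longrightarrow> mfps_no_const h \<Longrightarrow>
    mfps_compose (mfps_compose f g) h = mfps_compose f (mfps_compose g h)"
  by (simp add: mfps_compose_def[of f] mfps_compose_def[of "vec_lambda _"] subst_subst)

lemma compose_vars [simp]: "mfps_compose f mfps_vars = f"
  by (simp add: mfps_compose_def subst_vars)

lemma vars_compose: "mfps_no_const g \<Longrightarrow> mfps_compose mfps_vars g = g"
  by (simp add: mfps_compose_def subst_vars_nth)

lemma no_const_vars: "mfps_no_const mfps_vars"
  by (auto simp: mfps_no_const_def vars_nth coeff_monomial axis_def vec_eq_iff)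

lemma no_const_compose:
  assumes "mfps_no_const f"
  shows "mfps_no_const (mfps_compose f g)"
  using assms by (simp add: mfps_no_const_def mfps_compose_def coeff_subst)

lemma no_const_iter:
  assumes "mfps_no_const f"
  shows "mfps_no_const (mfps_iter k f)"
  by (cases k) (simp_all add: mfps_iter_def assms no_const_vars no_const_compose)

lemma iter_0 [simp]: "mfps_iter 0 f = mfps_vars"
  by (simp add: mfps_iter_def)

text \<open>Iterates are built by composing with \<open>f\<close> on the left; the linear operator is composition
  with \<open>f\<close> on the right.\<close>

lemma iter_Suc_right:
  assumes "mfps_no_const f"
  shows "mfps_iter (Suc k) f = mfps_compose (mfps_iter k f) f"
proof (induction k)
  case 0
  show ?case by (simp add: mfps_iter_def vars_compose assms)
next
  case (Suc k)
  have "mfps_iter (Suc (Suc k)) f = mfps_compose f (mfps_iter (Suc k) f)"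
    by (simp add: mfps_iter_def)
  also have "\<dots> = mfps_compose (mfps_compose f (mfps_iter k f)) f"
    by (simp add: Suc compose_assoc assms no_const_iter)
  also have "mfps_compose f (mfps_iter k f) = mfps_iter (Suc k) f"
    by (simp add: mfps_iter_def)
  finally show ?case .
qed

section \<open>The Neumann series\<close>

definition tangent_to_id :: "('a::comm_ring_1, 'n::finite) mfps ^ 'n \<Rightarrow> bool" where
  "tangent_to_id \<phi> \<longleftrightarrow> (\<forall>i. order_ge 2 (\<phi> $ i - mfps_vars $ i))"

lemma tangent_no_const:
  assumes "tangent_to_id \<phi>"
  shows "mfps_no_const \<phi>"
  using assms no_const_vars by (fastforce simp: tangent_to_id_def mfps_no_const_def order_ge_def)

text \<open>This is what makes the series converge: in the lowest degree of \<open>f\<close>, each monomial is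
  unchanged by the substitution.\<close>

lemma order_ge_minus_subst:
  fixes f :: "('a::comm_ring_1, 'n::finite) mfps"
  assumes \<phi>: "tangent_to_id \<phi>" and f: "order_ge k f"
  shows "order_ge (Suc k) (f - mfps_subst f \<phi>)"
  unfolding order_ge_def
proof (intro allI impI)
  fix e :: "nat ^ 'n"
  assume e: "mdeg e < Suc k"
  have eq: "mfps_coeff f d * mfps_coeff (mfps_monom_eval d mfps_vars) e =
      mfps_coeff f d * mfps_coeff (mfps_monom_eval d \<phi>) e" for d
  proof (cases "mdeg d < k")
    case True
    then show ?thesis using f by (simp add: order_ge_def)
  next
    case False
    have "order_ge (Suc (mdeg d)) (mfps_monom_eval d \<phi> - mfps_monom_eval d mfps_vars)"
      using \<phi> by (intro monom_eval_diff_order tangent_no_const no_const_vars)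
        (auto simp: tangent_to_id_def)
    then show ?thesis
      using False e by (simp add: order_ge_def)
  qed
  have "mfps_coeff (mfps_subst f mfps_vars) e = mfps_coeff (mfps_subst f \<phi>) e"
    unfolding coeff_subst by (intro sum.cong refl eq)
  then show "mfps_coeff (f - mfps_subst f \<phi>) e = 0"
    by (simp add: subst_vars)
qed

text \<open>Alternating binomial sums are the values at 0 of iterated differences of \<open>t\<close>. On the iterates
  of \<open>\<phi>\<close>, where \<open>C\<close> shifts the index, this is the identity
  \<open>(1 - C)\<^sup>m\<^sup>+\<^sup>1 = (1 - C)\<^sup>m - C (1 - C)\<^sup>m\<close>, obtained without iterating the operator itself.\<close>

lemma alternating_binomial_sum_Suc:
  fixes t :: "nat \<Rightarrow> 'a::comm_ring_1"
  shows "(\<Sum>k=0..Suc m. (-1) ^ k * of_nat (Suc m choose k) * t k) =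
    (\<Sum>k=0..m. (-1) ^ k * of_nat (m choose k) * t k) -
    (\<Sum>k=0..m. (-1) ^ k * of_nat (m choose k) * t (Suc k))"
proof -
  let ?u = "\<lambda>k. (-1) ^ k * of_nat (m choose k) * t k"
  \<comment> \<open>The extra term at \<open>k = m + 1\<close> vanishes, and it makes the ranges match after the shift.\<close>
  have "(\<Sum>k=0..m. ?u k) = (\<Sum>k=0..Suc m. ?u k)"
    by (simp add: binomial_eq_0)
  also have "\<dots> = t 0 + (\<Sum>k=0..m. ?u (Suc k))"
    by (subst sum.atLeast0_atMost_Suc_shift) simp
  finally have *: "(\<Sum>k=0..m. ?u k) = t 0 + (\<Sum>k=0..m. ?u (Suc k))" .
  have "(\<Sum>k=0..Suc m. (-1) ^ k * of_nat (Suc m choose k) * t k) =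
      t 0 + (\<Sum>k=0..m. (-1) ^ Suc k * of_nat (Suc m choose Suc k) * t (Suc k))"
    by (subst sum.atLeast0_atMost_Suc_shift) simp
  also have "\<dots> = t 0 + (\<Sum>k=0..m. ?u (Suc k)) -
      (\<Sum>k=0..m. (-1) ^ k * of_nat (m choose k) * t (Suc k))"
    unfolding add_diff_eq[symmetric] sum_subtractf[symmetric]
    by (intro arg_cong2[of _ _ _ _ "(+)"] sum.cong) (simp_all add: algebra_simps)
  finally show ?thesis by (simp only: *)
qed

definition neumann_term :: "('a::comm_ring_1, 'n::finite) mfps ^ 'n \<Rightarrow> nat \<Rightarrow> ('a, 'n) mfps ^ 'n" where
  "neumann_term \<phi> m = (\<Sum>k=0..m. ((-1) ^ k * of_nat (m choose k)) *s mfps_iter k \<phi>)"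

lemma neumann_term_nth:
  "neumann_term \<phi> m $ i = (\<Sum>k=0..m. (-1) ^ k * of_nat (m choose k) * (mfps_iter k \<phi> $ i))"
  by (simp add: neumann_term_def)

lemma neumann_term_0: "neumann_term \<phi> 0 = mfps_vars"
  by (simp add: vec_eq_iff neumann_term_nth)

lemma neumann_term_Suc:
  assumes "mfps_no_const \<phi>"
  shows "neumann_term \<phi> (Suc m) $ i =
    neumann_term \<phi> m $ i - mfps_subst (neumann_term \<phi> m $ i) \<phi>"
proof -
  have "mfps_subst ((-1) ^ k * of_nat (m choose k) * (mfps_iter k \<phi> $ i)) \<phi> =
      (-1) ^ k * of_nat (m choose k) * (mfps_iter (Suc k) \<phi> $ i)" for k
    by (simp add: subst_mult subst_power subst_minus subst_1 subst_of_nat assms iter_Suc_right)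
      (simp add: mfps_compose_def)
  then show ?thesis
    by (simp only: neumann_term_nth alternating_binomial_sum_Suc subst_sum)
qed

lemma neumann_term_order:
  assumes "tangent_to_id \<phi>"
  shows "order_ge (Suc m) (neumann_term \<phi> m $ i)"
proof (induction m)
  case 0
  show ?case
    using no_const_order_ge[OF no_const_vars] by (simp add: neumann_term_0)
next
  case (Suc m)
  then show ?case
    by (simp add: neumann_term_Suc order_ge_minus_subst assms tangent_no_const)
qed

lemma neumann_term_coeff_eq_0:
  "tangent_to_id \<phi> \<Longrightarrow> mdeg e \<le> m \<Longrightarrow> mfps_coeff (neumann_term \<phi> m $ i) e = 0"
  using neumann_term_order[of \<phi> m i] by (simp add: order_ge_def)

lemma neumann_summable:
  assumes "tangent_to_id \<phi>"
  shows "mfps_summable (neumann_term \<phi>) M"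
proof -
  have "{m \<in> M. mfps_coeff (neumann_term \<phi> m $ i) e \<noteq> 0} \<subseteq> {..<mdeg e}" for i e
    using neumann_term_coeff_eq_0[OF assms] by (auto simp: not_le[symmetric])
  then show ?thesis
    unfolding mfps_summable_def by (meson finite_lessThan finite_subset)
qed

lemma coeff_infsum_upto:
  assumes "tangent_to_id \<phi>" "mdeg e \<le> N"
  shows "mfps_coeff (mfps_infsum (neumann_term \<phi>) M $ i) e =
    (\<Sum>m | m \<in> M \<and> m \<le> N. mfps_coeff (neumann_term \<phi> m $ i) e)"
proof -
  have "m \<le> N" if "mfps_coeff (neumann_term \<phi> m $ i) e \<noteq> 0" for m
    using that neumann_term_coeff_eq_0[OF assms(1), of e m i] assms(2) by force
  then show ?thesis
    unfolding mfps_infsum_def by (simp, intro sum.mono_neutral_left) auto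
qed

lemma neumann_split_first:
  assumes "tangent_to_id \<phi>"
  shows "mfps_infsum (neumann_term \<phi>) {0..} = mfps_vars + mfps_infsum (neumann_term \<phi>) {1..}"
proof -
  have "mfps_infsum (neumann_term \<phi>) {0..} $ i =
      (mfps_vars + mfps_infsum (neumann_term \<phi>) {1..}) $ i" for i
  proof (rule mfps_eqI)
    fix e :: "nat ^ 'b"
    have "{m. m \<in> {0..} \<and> m \<le> mdeg e} = insert 0 {1..mdeg e}"
      "{m. m \<in> {1..} \<and> m \<le> mdeg e} = {1..mdeg e}"
      by auto
    then show "mfps_coeff (mfps_infsum (neumann_term \<phi>) {0..} $ i) e =
        mfps_coeff ((mfps_vars + mfps_infsum (neumann_term \<phi>) {1..}) $ i) e"
      by (simp only: coeff_infsum_upto[OF assms order_refl] vector_add_component coeff_add)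
        (simp add: neumann_term_0)
  qed
  then show ?thesis unfolding vec_eq_iff by blast
qed

text \<open>All terms after the first have order at least two. This lets the construction be applied to
  the sum itself, which turns left inverses into two-sided ones.\<close>

lemma neumann_series_tangent:
  assumes "tangent_to_id \<phi>"
  shows "tangent_to_id (mfps_infsum (neumann_term \<phi>) {0..})"
proof -
  have "mfps_coeff (mfps_infsum (neumann_term \<phi>) {1..} $ i) e = 0" if "mdeg e < 2" for i e
    using that by (auto simp: coeff_infsum_upto[OF assms order_refl]
        intro!: sum.neutral neumann_term_coeff_eq_0[OF assms])
  then show ?thesis
    unfolding neumann_split_first[OF assms] by (simp add: tangent_to_id_def order_ge_def)
qed

lemma neumann_series_left_inverse:
  fixes \<phi> :: "('a::comm_ring_1, 'n::finite) mfps ^ 'n"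
  assumes \<phi>: "tangent_to_id \<phi>"
  shows "mfps_compose (mfps_infsum (neumann_term \<phi>) {0..}) \<phi> = mfps_vars"
proof -
  let ?\<psi> = "mfps_infsum (neumann_term \<phi>) {0..}"
  have "mfps_subst (?\<psi> $ i) \<phi> = mfps_vars $ i" for i
  proof (rule mfps_eqI)
    fix e :: "nat ^ 'n"
    let ?s = "\<lambda>m. neumann_term \<phi> m $ i"
    have step: "mfps_subst (?s m) \<phi> = ?s m - ?s (Suc m)" for m
      by (simp add: neumann_term_Suc tangent_no_const[OF \<phi>])
    \<comment> \<open>The coefficient at \<open>e\<close> only sees the partial sum up to \<open>mdeg e\<close>, so linearity for
      finite sums suffices.\<close>
    have "mfps_coeff (mfps_subst (?\<psi> $ i) \<phi>) e = mfps_coeff (mfps_subst (\<Sum>m\<le>mdeg e. ?s m) \<phi>) e"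
      by (rule coeff_subst_cong) (simp add: coeff_infsum_upto[OF \<phi>] coeff_sum atMost_def)
    also have "\<dots> = mfps_coeff (?s 0 - ?s (Suc (mdeg e))) e"
      by (simp only: subst_sum step sum_telescope[of ?s])
    also have "\<dots> = mfps_coeff (mfps_vars $ i) e"
      by (simp add: neumann_term_0 neumann_term_coeff_eq_0[OF \<phi>])
    finally show "mfps_coeff (mfps_subst (?\<psi> $ i) \<phi>) e = mfps_coeff (mfps_vars $ i) e" .
  qed
  then show ?thesis
    by (simp add: mfps_compose_def vec_eq_iff)
qed

section \<open>The compositional inverse\<close>

lemma neumann_series_inverse:
  assumes \<phi>: "tangent_to_id \<phi>"
  shows "mfps_comp_inverse \<phi> (mfps_infsum (neumann_term \<phi>) {0..})"
proof -
  define \<psi> where "\<psi> = mfps_infsum (neumann_term \<phi>) {0..}"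
  define \<theta> where "\<theta> = mfps_infsum (neumann_term \<psi>) {0..}"
  have \<psi>: "tangent_to_id \<psi>" "mfps_compose \<psi> \<phi> = mfps_vars"
    using neumann_series_tangent[OF \<phi>] neumann_series_left_inverse[OF \<phi>] by (simp_all add: \<psi>_def)
  have \<theta>: "mfps_compose \<theta> \<psi> = mfps_vars"
    using neumann_series_left_inverse[OF \<psi>(1)] by (simp add: \<theta>_def)
  note no_const = tangent_no_const[OF \<phi>] tangent_no_const[OF \<psi>(1)]
  have "\<theta> = mfps_compose \<theta> (mfps_compose \<psi> \<phi>)"
    by (simp add: \<psi>(2))
  also have "\<dots> = mfps_compose (mfps_compose \<theta> \<psi>) \<phi>"
    by (simp add: compose_assoc no_const)
  also have "\<dots> = \<phi>"
    by (simp add: \<theta> vars_compose no_const)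
  finally show ?thesis
    using \<psi> \<theta> no_const unfolding mfps_comp_inverse_def \<psi>_def[symmetric] by simp
qed

lemma comp_inverse_unique:
  assumes f: "mfps_no_const f" and g: "mfps_comp_inverse f g" and h: "mfps_comp_inverse f h"
  shows "g = h"
proof -
  have "g = mfps_compose g (mfps_compose f h)"
    using h by (simp add: mfps_comp_inverse_def)
  also have "\<dots> = mfps_compose (mfps_compose g f) h"
    using h f by (simp add: mfps_comp_inverse_def compose_assoc)
  also have "\<dots> = h"
    using g h by (simp add: mfps_comp_inverse_def vars_compose)
  finally show ?thesis .
qed

theorem theorem3:
  fixes \<phi> :: "('a::field_char_0, 'n::finite) mfps ^ 'n"
  assumes "\<And>i e. mdeg e < 2 \<Longrightarrow> mfps_coeff (\<phi> $ i) e = mfps_coeff (mfps_vars $ i) e"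
  shows "(\<exists>!\<psi>. mfps_comp_inverse \<phi> \<psi>) \<and>
    (let s = (\<lambda>m::nat. \<Sum>k=0..m. ((-1) ^ k * of_nat (m choose k)) *s mfps_iter k \<phi>) in
      mfps_summable s {0..} \<and>
      mfps_inv \<phi> = mfps_infsum s {0..} \<and>
      mfps_infsum s {0..} = mfps_vars + mfps_infsum s {1..})"
proof -
  have \<phi>: "tangent_to_id \<phi>"
    using assms by (simp add: tangent_to_id_def order_ge_def)
  have inverse: "mfps_comp_inverse \<phi> (mfps_infsum (neumann_term \<phi>) {0..})"
    by (rule neumann_series_inverse[OF \<phi>])
  have unique: "\<exists>!\<psi>. mfps_comp_inverse \<phi> \<psi>"
    using inverse comp_inverse_unique[OF tangent_no_const[OF \<phi>]] by blast
  have "mfps_inv \<phi> = mfps_infsum (neumann_term \<phi>) {0..}"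
    unfolding mfps_inv_def by (rule the1_equality[OF unique inverse])
  then show ?thesis
    using unique neumann_summable[OF \<phi>] neumann_split_first[OF \<phi>]
    by (simp add: neumann_term_def[abs_def])
qed

end
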